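(* Let $\{p_k\}_{k=0,1,2,\ldots}$ be a system of orthogonal polynomials with respect to an orthogonality measure $\mu$ on $\mathbb{R}$, and put $h_k:=\int_{\mathbb{R}}p_k(\xi)^2\,d\mu(\xi)$. Let $m,n$ be integers with $0\le m\le n$. Let $x\in\mathbb{R}$. Let $I\subseteq\mathbb{R}$ be a closed interval such that, for some $\varepsilon>0$, $x+\delta\xi\in I$ if $0\le\delta\le\varepsilon$ and $\xi\in\operatorname{supp}(\mu)$. Let $f$ be a continuous function on $I$ such that its derivatives of order $1,2,\ldots,n$ at $x$ exist. In addition, if $I$ is unbounded, assume that $f$ is of at most polynomial growth on $I$. Then $$\frac1{\delta^m}\sum_{j=m}^n\frac1{h_j}\left(\int_{\mathbb{R}} f(x+\delta\xi)\,p_j(\xi)\,d\mu(\xi)\right)p_j^{(m)}(0)=f^{(m)}(x)+o(\delta^{n-m})\qquad\text{as }\delta\downarrow0.$$ If $f\in C^n(I)$ and $f^{(n)}$ is of polynomial growth on $I$, then this asymptotic formula holds uniformly for $x$ in compact subsets of $I$.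
   Context: An orthogonality measure is a positive Borel measure $\mu$ on $\mathbb{R}$ with $\int_{\mathbb{R}}|x|^k\,d\mu(x)<\infty$ for all integers $k\ge0$, whose support is infinite or (as is also allowed) a finite set of $N+1$ points. A system of orthogonal polynomials with respect to $\mu$ consists of polynomials $p_k$ of degree $k$ with $\int_{\mathbb{R}}p_j\,p_k\,d\mu=0$ for $j\ne k$; here $k$ ranges over all integers $\ge0$ if $\operatorname{supp}(\mu)$ is infinite, and only over $0,1,\ldots,N$ if $\operatorname{supp}(\mu)$ has $N+1$ points (so in that case $n\le N$). They are unique up to nonzero constant factors. $p_j^{(m)}$ denotes the $m$-th derivative of $p_j$. Derivatives at an endpoint of $I$ are interpreted as the corresponding one-sided derivatives. A function $g$ on $I$ is of (at most) polynomial growth if there are $C>0$, $r\ge0$ with $|g(y)|\le C(1+|y|)^r$ for all $y\in I$. *)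

theory Defs
  imports "HOL-Analysis.Analysis" "HOL-Library.Landau_Symbols"
    "HOL-Computational_Algebra.Polynomial"
begin

definition msupp :: "real measure \<Rightarrow> real set" where
  "msupp M = {x. \<forall>U. open U \<longrightarrow> x \<in> U \<longrightarrow> emeasure M U > 0}"

text \<open>A finite support must have \<open>N + 1\<close> points with \<open>N \<ge> 0\<close>, so the only support
  excluded is the empty one (the zero measure).\<close>

definition orthogonality_measure :: "real measure \<Rightarrow> bool" where
  "orthogonality_measure M \<longleftrightarrow>
     sets M = sets borel \<and>
     (\<forall>k::nat. integrable M (\<lambda>x. \<bar>x\<bar> ^ k)) \<and>
     msupp M \<noteq> {}"

text \<open>The index range: all \<open>k\<close> if the support is infinite, and \<open>0, \<dots>, N\<close> if it has
  \<open>N + 1\<close> points.\<close>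

definition op_degrees :: "real measure \<Rightarrow> nat set" where
  "op_degrees M = {k. infinite (msupp M) \<or> k < card (msupp M)}"

text \<open>The condition \<open>p k \<noteq> 0\<close> matters for \<open>k = 0\<close>, since \<open>degree 0 = 0\<close>.\<close>

definition orthogonal_polys :: "real measure \<Rightarrow> (nat \<Rightarrow> real poly) \<Rightarrow> bool" where
  "orthogonal_polys M p \<longleftrightarrow>
     (\<forall>k \<in> op_degrees M. p k \<noteq> 0 \<and> degree (p k) = k) \<and>
     (\<forall>j \<in> op_degrees M. \<forall>k \<in> op_degrees M. j \<noteq> k \<longrightarrow>
        (\<integral>\<xi>. poly (p j) \<xi> * poly (p k) \<xi> \<partial>M) = 0)"

definition sq_norm :: "real measure \<Rightarrow> (nat \<Rightarrow> real poly) \<Rightarrow> nat \<Rightarrow> real" where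
  "sq_norm M p k = (\<integral>\<xi>. (poly (p k) \<xi>)\<^sup>2 \<partial>M)"

definition poly_growth_on :: "real set \<Rightarrow> (real \<Rightarrow> real) \<Rightarrow> bool" where
  "poly_growth_on I g \<longleftrightarrow>
     (\<exists>C>0. \<exists>r\<ge>0. \<forall>y\<in>I. \<bar>g y\<bar> \<le> C * (1 + \<bar>y\<bar>) powr r)"

text \<open>Derivatives are taken within \<open>I\<close>, hence are one-sided at an endpoint of \<open>I\<close>.
  The value of \<open>nderiv_within\<close> is meaningful only where the derivative exists.\<close>

primrec nderiv_within :: "real set \<Rightarrow> nat \<Rightarrow> (real \<Rightarrow> real) \<Rightarrow> real \<Rightarrow> real" where
  "nderiv_within I 0 f = f"
| "nderiv_within I (Suc k) f =
     (\<lambda>x. vector_derivative (nderiv_within I k f) (at x within I))"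

text \<open>\<open>nth_diff_within I k f x\<close>: the derivative of order \<open>k\<close> of \<open>f\<close> at \<open>x\<close> exists, that of
  order \<open>k - 1\<close> being required to exist at all points of \<open>I\<close> near \<open>x\<close>.\<close>

primrec nth_diff_within :: "real set \<Rightarrow> nat \<Rightarrow> (real \<Rightarrow> real) \<Rightarrow> real \<Rightarrow> bool" where
  "nth_diff_within I 0 f x \<longleftrightarrow> True"
| "nth_diff_within I (Suc k) f x \<longleftrightarrow>
     (\<forall>\<^sub>F y in nhds x. y \<in> I \<longrightarrow> nth_diff_within I k f y) \<and>
     nderiv_within I k f differentiable (at x within I)"

definition C_n_on :: "nat \<Rightarrow> real set \<Rightarrow> (real \<Rightarrow> real) \<Rightarrow> bool" where
  "C_n_on n I f \<longleftrightarrow>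
     (\<forall>k<n. \<forall>x\<in>I. nderiv_within I k f differentiable (at x within I)) \<and>
     (\<forall>k\<le>n. continuous_on I (nderiv_within I k f))"

definition admissible :: "real measure \<Rightarrow> real set \<Rightarrow> real \<Rightarrow> bool" where
  "admissible M I x \<longleftrightarrow>
     (\<exists>\<epsilon>>0. \<forall>\<delta> \<xi>. 0 \<le> \<delta> \<longrightarrow> \<delta> \<le> \<epsilon> \<longrightarrow> \<xi> \<in> msupp M \<longrightarrow> x + \<delta> * \<xi> \<in> I)"

text \<open>The integral of \<open>f (x + \<delta> * \<xi>)\<close> is written over the support of \<open>M\<close>, the complement of
  which is a null set: outside of it \<open>x + \<delta> * \<xi>\<close> need not lie in the domain \<open>I\<close> of \<open>f\<close>, and
  an arbitrary extension of \<open>f\<close> need not be measurable.\<close>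

definition op_deriv ::
  "real measure \<Rightarrow> (nat \<Rightarrow> real poly) \<Rightarrow> nat \<Rightarrow> nat \<Rightarrow> (real \<Rightarrow> real) \<Rightarrow> real \<Rightarrow> real \<Rightarrow> real" where
  "op_deriv M p m n f x \<delta> =
     1 / \<delta> ^ m *
     (\<Sum>j=m..n. 1 / sq_norm M p j *
        (LINT \<xi>:msupp M|M. f (x + \<delta> * \<xi>) * poly (p j) \<xi>) *
        poly ((pderiv ^^ m) (p j)) 0)"

end

theory Submission
  imports Defs
begin

text \<open>
  For a polynomial \<open>q\<close> of degree at most \<open>n\<close> the sum over \<open>j\<close> reproduces the \<open>m\<close>-th
  derivative of \<open>q\<close> at \<open>0\<close> exactly, by differentiating the orthogonal expansion of \<open>q\<close>.
  Applied to the Taylor polynomial of \<open>f\<close> at \<open>x\<close>, as a polynomial in \<open>\<xi>\<close> with \<open>h = \<delta> * \<xi>\<close>, this leaves only the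
  contribution of the Taylor remainder. The Peano estimate near \<open>x\<close> and the polynomial growth away
  from \<open>x\<close> combine into a single estimate on all of \<open>I\<close>: for each \<open>\<eta> > 0\<close> the remainder is at most
  \<open>\<bar>h\<bar> ^ n * (\<eta> + D * \<bar>h\<bar> * (1 + h\<^sup>2) ^ N)\<close> with \<open>D\<close> depending on \<open>\<eta>\<close>. Since all moments
  exist, integration gives \<open>\<delta> ^ n * (O(\<eta>) + O(\<delta>))\<close>, without any limit theorem for integrals. If
  the estimate is uniform over \<open>x \<in> K\<close>, so is the limit; the pointwise statement is the case
  \<open>K = {x}\<close>.
\<close>

subsection \<open>Orthogonal expansion of polynomials\<close>

lemma closed_msupp: "closed (msupp M)"
proof -
  have "- msupp M = \<Union>{U. open U \<and> emeasure M U = 0}"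
    by (auto simp: msupp_def)
  then show ?thesis
    unfolding closed_def by (metis (no_types, lifting) open_Union mem_Collect_eq)
qed

text \<open>The complement of the support is a union of open null sets, possibly uncountable; the
  Lindelof property extracts a countable subfamily with the same union, which is therefore
  null.\<close>

lemma AE_msupp:
  assumes "sets M = sets borel"
  shows "AE x in M. x \<in> msupp M"
proof -
  define \<F> where "\<F> = {U. open U \<and> emeasure M U = 0}"
  have eq: "- msupp M = \<Union>\<F>"
    by (auto simp: msupp_def \<F>_def)
  obtain \<F>' where \<F>': "\<F>' \<subseteq> \<F>" "countable \<F>'" "\<Union>\<F>' = \<Union>\<F>"
    using Lindelof[of \<F>] by (auto simp: \<F>_def)
  have "(\<Union>U\<in>\<F>'. U) \<in> null_sets M"
    using \<F>' assms by (intro null_sets_UN') (auto simp: \<F>_def null_sets_def)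
  then have "- msupp M \<in> null_sets M"
    using eq \<F>' by simp
  then show ?thesis
    by (rule AE_I') auto
qed

text \<open>Every open set meeting the support has positive measure. This turns almost-everywhere
  vanishing of a continuous function into vanishing on the whole support.\<close>

lemma AE_imp_msupp:
  assumes "sets M = sets borel" "open {x. P x}" "AE x in M. \<not> P x" "x \<in> msupp M"
  shows "\<not> P x"
proof
  assume "P x"
  then have "emeasure M {x. P x} > 0"
    using assms(2,4) by (auto simp: msupp_def)
  moreover have "{x. P x} \<in> sets M"
    using assms(1,2) by simp
  moreover have "{x \<in> space M. P x} = {x. P x}"
    using sets_eq_imp_space_eq[OF assms(1)] by simp
  ultimately show False
    using assms(3) AE_iff_measurable[of "{x. P x}" M "\<lambda>x. \<not> P x"] by simp
qed

lemma borel_measurable_orthogonality_measure: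
  assumes "orthogonality_measure M"
  shows "borel_measurable M = (borel_measurable borel :: (real \<Rightarrow> real) set)"
  using assms by (intro measurable_cong_sets) (auto simp: orthogonality_measure_def)

lemma integrable_poly:
  assumes "orthogonality_measure M" and g: "\<And>x. g x = poly q x"
  shows "integrable M g"
proof -
  have pow: "integrable M (\<lambda>x. x ^ k)" for k
  proof (rule Bochner_Integration.integrable_bound)
    show "integrable M (\<lambda>x. \<bar>x\<bar> ^ k)"
      using assms by (auto simp: orthogonality_measure_def)
  qed (auto simp: borel_measurable_orthogonality_measure[OF assms(1)] power_abs)
  have "g = (\<lambda>x. \<Sum>i\<le>degree q. coeff q i * x ^ i)"
    by (auto simp: g poly_altdef)
  with pow show ?thesis by simp
qed

text \<open>A vanishing integral would force \<open>q\<close> to vanish on the support, which would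
  then have at most \<open>degree q\<close> points; membership in \<open>op_degrees M\<close>
  excludes this.\<close>

lemma integral_poly_square_pos:
  assumes "orthogonality_measure M" "q \<noteq> 0" "degree q \<in> op_degrees M"
  shows "(\<integral>x. (poly q x)\<^sup>2 \<partial>M) > 0"
proof (rule ccontr)
  have sets: "sets M = sets borel"
    using assms by (simp add: orthogonality_measure_def)
  have int: "integrable M (\<lambda>x. (poly q x)\<^sup>2)"
    by (rule integrable_poly[OF assms(1), where q = "q\<^sup>2"]) simp
  assume "\<not> ?thesis"
  then have "(\<integral>x. (poly q x)\<^sup>2 \<partial>M) = 0"
    by (intro antisym Bochner_Integration.integral_nonneg) (auto simp: not_less)
  then have "AE x in M. \<not> (poly q x \<noteq> 0)"
    using integral_nonneg_eq_0_iff_AE[OF int] by simp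
  moreover have "open {x. poly q x \<noteq> 0}"
    by (intro open_Collect_neq continuous_intros)
  ultimately have sub: "msupp M \<subseteq> {x. poly q x = 0}"
    using AE_imp_msupp[OF sets, of "\<lambda>x. poly q x \<noteq> 0"] by blast
  then have fin: "finite (msupp M)" and "card (msupp M) \<le> card {x. poly q x = 0}"
    using poly_roots_finite[OF assms(2)] finite_subset card_mono by blast+
  with card_poly_roots_bound[OF assms(2)] assms(3) show False
    by (simp add: op_degrees_def)
qed

section \<open>Expansion of polynomials and its derivatives at zero\<close>

lemma op_degrees_le: "n \<in> op_degrees M \<Longrightarrow> k \<le> n \<Longrightarrow> k \<in> op_degrees M"
  by (auto simp: op_degrees_def)

text \<open>Subtracting the multiple of \<open>p (Suc n)\<close> that has the same coefficient of
  order \<open>Suc n\<close> lowers the degree, so induction on \<open>n\<close> applies.\<close>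

lemma graded_poly_span:
  fixes p :: "nat \<Rightarrow> 'a :: field poly"
  assumes "\<And>k. k \<le> n \<Longrightarrow> p k \<noteq> 0 \<and> degree (p k) = k" "degree q \<le> n"
  shows "\<exists>a. q = (\<Sum>j\<le>n. smult (a j) (p j))"
  using assms
proof (induction n arbitrary: q)
  case 0
  obtain a b where "p 0 = [:a:]" "q = [:b:]"
    using 0 by (metis degree_eq_zeroE le_zero_eq order_refl)
  moreover have "p 0 \<noteq> 0"
    using 0(1) by auto
  ultimately have "q = smult (b / a) (p 0)"
    by auto
  then show ?case by auto
next
  case (Suc n)
  define b where "b = coeff q (Suc n) / lead_coeff (p (Suc n))"
  have p: "degree (p (Suc n)) = Suc n" "coeff (p (Suc n)) (Suc n) \<noteq> 0"
    using Suc.prems(1)[of "Suc n"] by (metis order_refl leading_coeff_0_iff)+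
  define r where "r = q - smult b (p (Suc n))"
  have "degree r \<le> Suc n"
    unfolding r_def using Suc.prems(2) p by (intro degree_diff_le) auto
  moreover have "coeff r (Suc n) = 0"
    using p by (simp add: r_def b_def)
  ultimately have "degree r \<le> n"
    by (metis leading_coeff_0_iff le_SucE degree_0 le0)
  then obtain a where a: "r = (\<Sum>j\<le>n. smult (a j) (p j))"
    using Suc.IH[of r] Suc.prems(1) by auto
  have "q = (\<Sum>j\<le>Suc n. smult ((a(Suc n := b)) j) (p j))"
    using a by (simp add: r_def algebra_simps)
  then show ?case by blast
qed

lemma higher_pderiv_eq_0: "degree p < m \<Longrightarrow> (pderiv ^^ m) p = (0 :: real poly)"
  by (intro poly_eqI) (simp add: coeff_higher_pderiv coeff_eq_0)

lemma poly_higher_pderiv_0: "poly ((pderiv ^^ m) p) 0 = fact m * coeff (p :: real poly) m"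
  by (simp add: poly_0_coeff_0 coeff_higher_pderiv pochhammer_fact)

text \<open>Orthogonality identifies the coefficients of \<open>q\<close> in the basis
  \<open>p j\<close> with the normalised integrals; differentiating the expansion termwise yields
  the \<open>m\<close>-th derivative of \<open>q\<close> at \<open>0\<close>.\<close>

lemma orthogonal_expansion_deriv:
  assumes M: "orthogonality_measure M" and p: "orthogonal_polys M p"
    and n: "n \<in> op_degrees M" and mn: "m \<le> n" and q: "degree q \<le> n"
  shows "(\<Sum>j=m..n. 1 / sq_norm M p j * (\<integral>\<xi>. poly q \<xi> * poly (p j) \<xi> \<partial>M) *
           poly ((pderiv ^^ m) (p j)) 0) = fact m * coeff q m"
proof -
  have deg: "p k \<noteq> 0 \<and> degree (p k) = k" if "k \<le> n" for k
    using p op_degrees_le[OF n that] by (auto simp: orthogonal_polys_def)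
  obtain a where a: "q = (\<Sum>j\<le>n. smult (a j) (p j))"
    using graded_poly_span[OF deg q] by blast
  have int: "integrable M (\<lambda>\<xi>. poly r \<xi> * poly s \<xi>)" for r s
    by (rule integrable_poly[OF M, where q = "r * s"]) simp
  have coef: "1 / sq_norm M p j * (\<integral>\<xi>. poly q \<xi> * poly (p j) \<xi> \<partial>M) = a j" if j: "j \<le> n" for j
  proof -
    have "(\<integral>\<xi>. poly q \<xi> * poly (p j) \<xi> \<partial>M)
          = (\<integral>\<xi>. (\<Sum>i\<le>n. a i * (poly (p i) \<xi> * poly (p j) \<xi>)) \<partial>M)"
      by (simp add: a poly_sum sum_distrib_right mult.assoc)
    also have "\<dots> = (\<Sum>i\<le>n. a i * (\<integral>\<xi>. poly (p i) \<xi> * poly (p j) \<xi> \<partial>M))"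
      using int by (subst Bochner_Integration.integral_sum) auto
    also have "\<dots> = (\<Sum>i\<le>n. if i = j then a j * sq_norm M p j else 0)"
      using p op_degrees_le[OF n] j
      by (intro sum.cong) (auto simp: orthogonal_polys_def sq_norm_def power2_eq_square)
    also have "\<dots> = a j * sq_norm M p j"
      using j by simp
    finally show ?thesis
      using integral_poly_square_pos[OF M, of "p j"] deg[OF j] op_degrees_le[OF n j]
      by (simp add: sq_norm_def)
  qed
  have "(\<Sum>j=m..n. 1 / sq_norm M p j * (\<integral>\<xi>. poly q \<xi> * poly (p j) \<xi> \<partial>M) *
           poly ((pderiv ^^ m) (p j)) 0) = (\<Sum>j=m..n. a j * poly ((pderiv ^^ m) (p j)) 0)"
    by (intro sum.cong refl) (simp only: coef atLeastAtMost_iff)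
  \<comment> \<open>The terms with \<open>j < m\<close> may be added because \<open>m\<close>
    differentiations annihilate a polynomial of degree \<open>j\<close>.\<close>
  also have "\<dots> = (\<Sum>j\<le>n. a j * poly ((pderiv ^^ m) (p j)) 0)"
    using deg by (intro sum.mono_neutral_left) (auto simp: higher_pderiv_eq_0)
  also have "\<dots> = poly ((pderiv ^^ m) q) 0"
    by (simp add: a higher_pderiv_sum higher_pderiv_smult poly_sum)
  finally show ?thesis
    by (simp add: poly_higher_pderiv_0)
qed

subsection \<open>From a Taylor estimate to the limit\<close>

text \<open>Here \<open>c k x\<close> stands for the Taylor coefficient of order \<open>k\<close> at
  \<open>x\<close>. The exponent \<open>N\<close> is fixed before \<open>\<eta>\<close>, while
  \<open>D\<close> may depend on \<open>\<eta>\<close>: first \<open>\<eta>\<close> is chosen small,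
  then \<open>\<delta>\<close> is taken small against \<open>D\<close>.\<close>

lemma op_deriv_uniform_limit:
  fixes c :: "nat \<Rightarrow> real \<Rightarrow> real"
  assumes M: "orthogonality_measure M" and p: "orthogonal_polys M p"
    and mn: "m \<le> n" and n: "n \<in> op_degrees M"
    and f: "continuous_on I f"
    and "\<epsilon> > 0"
    and adm: "\<And>x \<delta> \<xi>. x \<in> K \<Longrightarrow> 0 \<le> \<delta> \<Longrightarrow> \<delta> \<le> \<epsilon> \<Longrightarrow> \<xi> \<in> msupp M \<Longrightarrow> x + \<delta> * \<xi> \<in> I"
    and rem: "\<And>\<eta>. \<eta> > 0 \<Longrightarrow> \<exists>D. \<forall>x\<in>K. \<forall>h. x + h \<in> I \<longrightarrow>
       \<bar>f (x + h) - (\<Sum>k\<le>n. c k x * h ^ k)\<bar> \<le> \<bar>h\<bar> ^ n * (\<eta> + D * \<bar>h\<bar> * (1 + h\<^sup>2) ^ N)"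
  shows "uniform_limit K (\<lambda>\<delta> x. (op_deriv M p m n f x \<delta> - fact m * c m x) / \<delta> ^ (n - m))
           (\<lambda>_. 0) (at_right 0)"
proof (rule uniform_limitI)
  fix e :: real assume "e > 0"
  have sets: "sets M = sets borel"
    using M by (simp add: orthogonality_measure_def)
  have msupp_sets: "msupp M \<in> sets borel"
    using closed_msupp by auto
  note AE = AE_msupp[OF sets]
  define w where "w j = 1 / sq_norm M p j * poly ((pderiv ^^ m) (p j)) 0" for j
  \<comment> \<open>The functions \<open>a\<close> and \<open>b\<close> carry the two parts of the
    remainder estimate after multiplication by \<open>p j\<close>. As absolute values of polynomials
    they have finite integrals, independent of \<open>x\<close> and \<open>\<delta>\<close>.\<close>
  define a where "a j \<xi> = \<bar>\<xi> ^ n * poly (p j) \<xi>\<bar>" for j \<xi>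
  define b where "b j \<xi> = \<bar>\<xi> ^ Suc n * (1 + \<xi>\<^sup>2) ^ N * poly (p j) \<xi>\<bar>" for j \<xi>
  have int_a: "integrable M (a j)" for j
    unfolding a_def
    by (intro integrable_abs integrable_poly[OF M, where q = "monom 1 n * p j"]) (simp add: poly_monom)
  have int_b: "integrable M (b j)" for j
    unfolding b_def
    by (intro integrable_abs integrable_poly[OF M, where q = "monom 1 (Suc n) * [:1, 0, 1:] ^ N * p j"])
      (simp add: poly_monom power2_eq_square)
  define A where "A = (\<Sum>j=m..n. \<bar>w j\<bar> * (\<integral>\<xi>. a j \<xi> \<partial>M))"
  define B where "B = (\<Sum>j=m..n. \<bar>w j\<bar> * (\<integral>\<xi>. b j \<xi> \<partial>M))"
  have "A \<ge> 0" "B \<ge> 0"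
    unfolding A_def B_def a_def b_def
    by (intro sum_nonneg mult_nonneg_nonneg Bochner_Integration.integral_nonneg; simp)+
  \<comment> \<open>Half of \<open>e\<close> is reserved for the \<open>\<eta>\<close> part:
    \<open>\<eta> * A \<le> e / 2\<close>. The added \<open>1\<close> guards against
    \<open>A = 0\<close>.\<close>
  define \<eta> where "\<eta> = e / (2 * (A + 1))"
  have "\<eta> > 0"
    using \<open>e > 0\<close> \<open>A \<ge> 0\<close> by (simp add: \<eta>_def)
  obtain D0 where D0: "\<And>x h. x \<in> K \<Longrightarrow> x + h \<in> I \<Longrightarrow>
      \<bar>f (x + h) - (\<Sum>k\<le>n. c k x * h ^ k)\<bar> \<le> \<bar>h\<bar> ^ n * (\<eta> + D0 * \<bar>h\<bar> * (1 + h\<^sup>2) ^ N)"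
    using rem[OF \<open>\<eta> > 0\<close>] by blast
  define D where "D = \<bar>D0\<bar>"
  have D: "\<bar>f (x + h) - (\<Sum>k\<le>n. c k x * h ^ k)\<bar> \<le> \<bar>h\<bar> ^ n * (\<eta> + D * \<bar>h\<bar> * (1 + h\<^sup>2) ^ N)"
    if "x \<in> K" "x + h \<in> I" for x h
  proof -
    have "D0 * \<bar>h\<bar> * (1 + h\<^sup>2) ^ N \<le> D * \<bar>h\<bar> * (1 + h\<^sup>2) ^ N"
      by (intro mult_right_mono) (auto simp: D_def)
    then show ?thesis
      by (intro order_trans[OF D0[OF that]] mult_left_mono) auto
  qed
  \<comment> \<open>The bound \<open>1\<close> gives
    \<open>(\<delta> * \<xi>)\<^sup>2 \<le> \<xi>\<^sup>2\<close>, the bound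
    \<open>\<epsilon>\<close> keeps the arguments of \<open>f\<close> in \<open>I\<close>, and the
    last one makes \<open>\<delta> * D * B < e / 2\<close>.\<close>
  define \<delta>0 where "\<delta>0 = min (min 1 \<epsilon>) (e / (2 * (D * B + 1)))"
  have "D \<ge> 0"
    by (simp add: D_def)
  have "\<delta>0 > 0"
    using \<open>e > 0\<close> \<open>\<epsilon> > 0\<close> \<open>D \<ge> 0\<close> \<open>B \<ge> 0\<close> by (auto simp: \<delta>0_def intro!: divide_pos_pos add_nonneg_pos)
  have main: "\<bar>(op_deriv M p m n f x \<delta> - fact m * c m x) / \<delta> ^ (n - m)\<bar> < e"
    if x: "x \<in> K" and \<delta>: "0 < \<delta>" "\<delta> < \<delta>0" for x \<delta>
  proof -
    have "0 < 2 * (D * B + 1)"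
      using \<open>D \<ge> 0\<close> \<open>B \<ge> 0\<close> by (simp add: add_nonneg_pos)
    then have \<delta>': "\<delta> \<le> 1" "\<delta> \<le> \<epsilon>" "\<delta> * (D * B + 1) < e / 2"
      using \<delta>(2) by (auto simp: \<delta>0_def pos_less_divide_eq algebra_simps)
    \<comment> \<open>The Taylor polynomial for the increment \<open>\<delta> * \<xi>\<close>, read
      as a polynomial in \<open>\<xi>\<close>; the powers of \<open>\<delta>\<close> sit in its
      coefficients.\<close>
    define q where "q = (\<Sum>k\<le>n. monom (c k x * \<delta> ^ k) k)"
    have poly_q: "poly q \<xi> = (\<Sum>k\<le>n. c k x * (\<delta> * \<xi>) ^ k)" for \<xi>
      by (simp add: q_def poly_sum poly_monom power_mult_distrib mult.assoc)
    have deg_q: "degree q \<le> n"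
      unfolding q_def by (intro degree_sum_le) (auto intro: order_trans[OF degree_monom_le])
    have coeff_q: "coeff q m = c m x * \<delta> ^ m"
      using mn by (simp add: q_def coeff_sum)
    \<comment> \<open>The remainder is cut off outside the support, where \<open>f\<close> is
      uncontrolled; continuity on the closed support makes \<open>g\<close> Borel
      measurable.\<close>
    define g where "g \<xi> = indicator (msupp M) \<xi> * (f (x + \<delta> * \<xi>) - poly q \<xi>)" for \<xi>
    define E where "E j = (\<integral>\<xi>. g \<xi> * poly (p j) \<xi> \<partial>M)" for j
    have g_meas: "g \<in> borel_measurable borel"
    proof -
      have "continuous_on (msupp M) (\<lambda>\<xi>. f (x + \<delta> * \<xi>) - poly q \<xi>)"
        using adm[OF x] \<delta> \<delta>'
        by (intro continuous_intros continuous_on_compose2[OF f]) auto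
      from borel_measurable_continuous_on_indicator[OF msupp_sets this] show ?thesis
        by (simp add: g_def[abs_def])
    qed
    have bound: "\<bar>g \<xi> * poly (p j) \<xi>\<bar> \<le> \<delta> ^ n * (\<eta> * a j \<xi> + \<delta> * D * b j \<xi>)" for \<xi> j
    proof (cases "\<xi> \<in> msupp M")
      case True
      have "x + \<delta> * \<xi> \<in> I"
        using adm[OF x _ _ True] \<delta> \<delta>' by simp
      have "(\<delta> * \<xi>)\<^sup>2 \<le> \<xi>\<^sup>2"
        using \<delta> \<delta>' by (simp add: power_mult_distrib mult_left_le_one_le power_le_one)
      then have sq: "(1 + (\<delta> * \<xi>)\<^sup>2) ^ N \<le> (1 + \<xi>\<^sup>2) ^ N"
        by (intro power_mono) auto
      from D[OF x \<open>x + \<delta> * \<xi> \<in> I\<close>]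
      have "\<bar>g \<xi>\<bar> \<le> \<bar>\<delta> * \<xi>\<bar> ^ n * (\<eta> + D * \<bar>\<delta> * \<xi>\<bar> * (1 + (\<delta> * \<xi>)\<^sup>2) ^ N)"
        using True by (simp add: g_def poly_q)
      also have "\<dots> \<le> \<bar>\<delta> * \<xi>\<bar> ^ n * (\<eta> + D * \<bar>\<delta> * \<xi>\<bar> * (1 + \<xi>\<^sup>2) ^ N)"
        using \<open>D \<ge> 0\<close> by (intro mult_left_mono add_left_mono sq) auto
      also have "\<dots> = \<delta> ^ n * (\<bar>\<xi>\<bar> ^ n * (\<eta> + \<delta> * D * \<bar>\<xi>\<bar> * (1 + \<xi>\<^sup>2) ^ N))"
        using \<delta> by (simp add: abs_mult power_mult_distrib algebra_simps)
      finally have "\<bar>g \<xi>\<bar> * \<bar>poly (p j) \<xi>\<bar> \<le>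
          \<delta> ^ n * (\<bar>\<xi>\<bar> ^ n * (\<eta> + \<delta> * D * \<bar>\<xi>\<bar> * (1 + \<xi>\<^sup>2) ^ N)) * \<bar>poly (p j) \<xi>\<bar>"
        by (rule mult_right_mono) simp
      also have "\<dots> = \<delta> ^ n * (\<eta> * a j \<xi> + \<delta> * D * b j \<xi>)"
        by (simp add: a_def b_def abs_mult power_abs algebra_simps)
      finally show ?thesis
        by (simp add: abs_mult)
    next
      case False
      then show ?thesis
        using \<delta> \<open>\<eta> > 0\<close> \<open>D \<ge> 0\<close> by (simp add: g_def a_def b_def)
    qed
    have int_bound: "integrable M (\<lambda>\<xi>. \<delta> ^ n * (\<eta> * a j \<xi> + \<delta> * D * b j \<xi>))" for j
      using int_a int_b by simp
    have int_g: "integrable M (\<lambda>\<xi>. g \<xi> * poly (p j) \<xi>)" for j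
    proof (rule Bochner_Integration.integrable_bound[OF int_bound[of j]])
      show "(\<lambda>\<xi>. g \<xi> * poly (p j) \<xi>) \<in> borel_measurable M"
        unfolding borel_measurable_orthogonality_measure[OF M]
        by (intro borel_measurable_times g_meas borel_measurable_continuous_onI continuous_intros)
      show "AE \<xi> in M. norm (g \<xi> * poly (p j) \<xi>) \<le> norm (\<delta> ^ n * (\<eta> * a j \<xi> + \<delta> * D * b j \<xi>))"
        using bound[of _ j] by (intro AE_I2) (auto intro: order_trans[OF _ abs_ge_self])
    qed
    have E: "\<bar>E j\<bar> \<le> \<delta> ^ n * (\<eta> * (\<integral>\<xi>. a j \<xi> \<partial>M) + \<delta> * D * (\<integral>\<xi>. b j \<xi> \<partial>M))" for j
    proof -
      have "\<bar>E j\<bar> \<le> (\<integral>\<xi>. \<bar>g \<xi> * poly (p j) \<xi>\<bar> \<partial>M)"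
        unfolding E_def by (rule integral_abs_bound)
      also have "\<dots> \<le> (\<integral>\<xi>. \<delta> ^ n * (\<eta> * a j \<xi> + \<delta> * D * b j \<xi>) \<partial>M)"
        using int_g by (intro integral_mono int_bound bound integrable_abs)
      finally show ?thesis
        using int_a int_b by simp
    qed
    \<comment> \<open>The complement of the support is null, so the polynomial part may be
      integrated over the whole line, where the orthogonal expansion applies.\<close>
    have split: "(LINT \<xi>:msupp M|M. f (x + \<delta> * \<xi>) * poly (p j) \<xi>)
        = (\<integral>\<xi>. poly q \<xi> * poly (p j) \<xi> \<partial>M) + E j" for j
    proof -
      have int_q: "integrable M (\<lambda>\<xi>. poly q \<xi> * poly (p j) \<xi>)"
        by (rule integrable_poly[OF M, where q = "q * p j"]) simp
      have "(LINT \<xi>:msupp M|M. f (x + \<delta> * \<xi>) * poly (p j) \<xi>)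
          = (\<integral>\<xi>. poly q \<xi> * poly (p j) \<xi> + g \<xi> * poly (p j) \<xi> \<partial>M)"
        unfolding set_lebesgue_integral_def
      proof (rule integral_cong_AE)
        have "continuous_on (msupp M) (\<lambda>\<xi>. f (x + \<delta> * \<xi>) * poly (p j) \<xi>)"
          using adm[OF x] \<delta> \<delta>'
          by (intro continuous_intros continuous_on_compose2[OF f]) auto
        from borel_measurable_continuous_on_indicator[OF msupp_sets this]
        show "(\<lambda>\<xi>. indicat_real (msupp M) \<xi> *\<^sub>R (f (x + \<delta> * \<xi>) * poly (p j) \<xi>)) \<in> borel_measurable M"
          by (simp add: borel_measurable_orthogonality_measure[OF M])
        show "AE \<xi> in M. indicat_real (msupp M) \<xi> *\<^sub>R (f (x + \<delta> * \<xi>) * poly (p j) \<xi>)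
            = poly q \<xi> * poly (p j) \<xi> + g \<xi> * poly (p j) \<xi>"
          using AE by eventually_elim (simp add: g_def algebra_simps)
      qed (use int_q int_g[of j] in auto)
      also have "\<dots> = (\<integral>\<xi>. poly q \<xi> * poly (p j) \<xi> \<partial>M) + E j"
        using int_q int_g by (simp add: E_def)
      finally show ?thesis .
    qed
    have "op_deriv M p m n f x \<delta> = 1 / \<delta> ^ m *
        ((\<Sum>j=m..n. 1 / sq_norm M p j * (\<integral>\<xi>. poly q \<xi> * poly (p j) \<xi> \<partial>M) *
           poly ((pderiv ^^ m) (p j)) 0) + (\<Sum>j=m..n. w j * E j))"
      unfolding op_deriv_def split by (simp add: w_def algebra_simps sum.distrib add_divide_distrib)
    \<comment> \<open>By exactness on polynomials of degree at most \<open>n\<close>, subtracting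
      the derivative leaves only the remainder terms \<open>E j\<close>.\<close>
    also have "\<dots> = 1 / \<delta> ^ m * (fact m * (c m x * \<delta> ^ m) + (\<Sum>j=m..n. w j * E j))"
      by (simp only: orthogonal_expansion_deriv[OF M p n mn deg_q] coeff_q)
    finally have "op_deriv M p m n f x \<delta> - fact m * c m x = (\<Sum>j=m..n. w j * E j) / \<delta> ^ m"
      using \<delta> by (simp add: field_simps)
    then have "(op_deriv M p m n f x \<delta> - fact m * c m x) / \<delta> ^ (n - m) = (\<Sum>j=m..n. w j * E j) / \<delta> ^ n"
      using mn by (simp add: power_add[symmetric])
    moreover have "\<bar>\<Sum>j=m..n. w j * E j\<bar> \<le> \<delta> ^ n * (\<eta> * A + \<delta> * D * B)"
    proof -
      have "\<bar>\<Sum>j=m..n. w j * E j\<bar> \<le> (\<Sum>j=m..n. \<bar>w j\<bar> * \<bar>E j\<bar>)"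
        using sum_abs[of "\<lambda>j. w j * E j"] by (simp add: abs_mult)
      also have "\<dots> \<le> (\<Sum>j=m..n. \<bar>w j\<bar> * (\<delta> ^ n * (\<eta> * (\<integral>\<xi>. a j \<xi> \<partial>M) + \<delta> * D * (\<integral>\<xi>. b j \<xi> \<partial>M))))"
        by (intro sum_mono mult_left_mono E) simp
      also have "\<dots> = \<delta> ^ n * (\<eta> * A + \<delta> * D * B)"
        unfolding A_def B_def by (simp add: sum_distrib_left sum.distrib[symmetric] algebra_simps)
      finally show ?thesis .
    qed
    ultimately have "\<bar>(op_deriv M p m n f x \<delta> - fact m * c m x) / \<delta> ^ (n - m)\<bar> \<le> \<eta> * A + \<delta> * D * B"
      using \<delta> by (simp add: abs_divide divide_le_eq mult.commute)
    also have "\<eta> * A \<le> e / 2"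
      using \<open>A \<ge> 0\<close> \<open>e > 0\<close> by (simp add: \<eta>_def field_simps)
    also have "\<delta> * D * B < e / 2"
      using \<delta>'(3) \<delta>(1) by (simp add: algebra_simps)
    finally show ?thesis by simp
  qed
  show "\<forall>\<^sub>F \<delta> in at_right 0. \<forall>x\<in>K.
      dist ((op_deriv M p m n f x \<delta> - fact m * c m x) / \<delta> ^ (n - m)) 0 < e"
    unfolding eventually_at_right_field using main \<open>\<delta>0 > 0\<close> by (auto simp: dist_real_def)
qed

subsection \<open>Taylor remainder estimates\<close>

text \<open>The bound on \<open>G n\<close> is integrated from \<open>x\<close> step by step, using
  the mean value inequality on the segment from \<open>x\<close> to \<open>y\<close>; each step
  gains one power of \<open>\<bar>y - x\<bar>\<close>. The constant is not improved by the numerical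
  factors that exact integration would give.\<close>

lemma vanishing_jet_bound:
  fixes G :: "nat \<Rightarrow> real \<Rightarrow> real"
  assumes "convex S" "x \<in> S" "B \<ge> 0"
    and "\<And>k y. k < n \<Longrightarrow> y \<in> S \<Longrightarrow> (G k has_real_derivative G (Suc k) y) (at y within S)"
    and "\<And>k. k < n \<Longrightarrow> G k x = 0"
    and "\<And>y. y \<in> S \<Longrightarrow> \<bar>G n y\<bar> \<le> B * \<bar>y - x\<bar> ^ q"
    and "y \<in> S"
  shows "\<bar>G 0 y\<bar> \<le> B * \<bar>y - x\<bar> ^ (n + q)"
  using assms(4-)
proof (induction n arbitrary: G y)
  case 0
  then show ?case by simp
next
  case (Suc n)
  have IH: "\<bar>G (Suc 0) z\<bar> \<le> B * \<bar>z - x\<bar> ^ (n + q)" if "z \<in> S" for z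
    using Suc.IH[of "\<lambda>k. G (Suc k)" z] Suc.prems that by auto
  have seg: "closed_segment x y \<subseteq> S"
    using assms(1,2) Suc.prems by (simp add: closed_segment_subset)
  have "norm (G 0 y - G 0 x) \<le> B * \<bar>y - x\<bar> ^ (n + q) * norm (y - x)"
  proof (rule field_differentiable_bound[of "closed_segment x y"])
    fix z assume z: "z \<in> closed_segment x y"
    then show "(G 0 has_real_derivative G (Suc 0) z) (at z within closed_segment x y)"
      using seg Suc.prems(1)[of 0 z] DERIV_subset by blast
    have "\<bar>z - x\<bar> ^ (n + q) \<le> \<bar>y - x\<bar> ^ (n + q)"
      using z by (intro power_mono) (auto simp: closed_segment_eq_real_ivl split: if_splits)
    then show "norm (G (Suc 0) z) \<le> B * \<bar>y - x\<bar> ^ (n + q)"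
      using IH[of z] z seg \<open>B \<ge> 0\<close> by (auto intro: order_trans mult_left_mono)
  qed auto
  then show ?case
    using Suc.prems(2)[of 0] by (simp add: mult_ac)
qed

lemma has_real_derivative_taylor_poly:
  fixes a :: "nat \<Rightarrow> real"
  shows "((\<lambda>y. \<Sum>j\<le>Suc N. a j / fact j * (y - x) ^ j) has_real_derivative
    (\<Sum>j\<le>N. a (Suc j) / fact j * (y - x) ^ j)) (at y within S)"
  unfolding sum.atMost_Suc_shift
  by (rule derivative_eq_intros refl | simp del: fact_Suc)+
    (auto intro!: sum.cong simp: divide_simps mult_ac simp flip: of_nat_Suc)

text \<open>An estimate for the Taylor remainder of the \<open>k\<close>-th derivative is integrated
  \<open>k\<close> times. For \<open>k = n - 1\<close> that estimate expresses differentiability at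
  \<open>x\<close>; for \<open>k = n\<close> it bounds the oscillation of the top
  derivative.\<close>

lemma taylor_remainder_bound:
  fixes F :: "nat \<Rightarrow> real \<Rightarrow> real"
  assumes "convex S" "x \<in> S" "y \<in> S" "B \<ge> 0" "k \<le> n"
    and F: "\<And>i y. i < k \<Longrightarrow> y \<in> S \<Longrightarrow> (F i has_real_derivative F (Suc i) y) (at y within S)"
    and top: "\<And>y. y \<in> S \<Longrightarrow>
      \<bar>F k y - (\<Sum>j\<le>n - k. F (k + j) x / fact j * (y - x) ^ j)\<bar> \<le> B * \<bar>y - x\<bar> ^ (n - k)"
  shows "\<bar>F 0 y - (\<Sum>j\<le>n. F j x / fact j * (y - x) ^ j)\<bar> \<le> B * \<bar>y - x\<bar> ^ n"
proof -
  \<comment> \<open>The remainder of \<open>F i\<close> to order \<open>n - i\<close>.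
    Differentiation shifts the Taylor coefficients, so it takes \<open>G i\<close> to
    \<open>G (Suc i)\<close>; for \<open>i < k\<close> the value at \<open>x\<close> is
    zero.\<close>
  define G where "G i y = F i y - (\<Sum>j\<le>n - i. F (i + j) x / fact j * (y - x) ^ j)" for i y
  have "\<bar>G 0 y\<bar> \<le> B * \<bar>y - x\<bar> ^ (k + (n - k))"
  proof (rule vanishing_jet_bound[OF assms(1,2,4) _ _ _ assms(3)])
    fix i z assume i: "i < k" and z: "z \<in> S"
    have n: "n - i = Suc (n - Suc i)"
      using i assms(5) by simp
    show "(G i has_real_derivative G (Suc i) z) (at z within S)"
      using DERIV_diff[OF F[OF i z]
          has_real_derivative_taylor_poly[where a = "\<lambda>j. F (i + j) x" and N = "n - Suc i"]]
      by (simp add: G_def[abs_def] n)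
  next
    show "G i x = 0" if "i < k" for i
      by (simp add: G_def power_0_left if_distrib sum.delta cong: if_cong)
  qed (use top in \<open>auto simp: G_def\<close>)
  then show ?thesis
    using assms(5) by (simp add: G_def)
qed

section \<open>Polynomial growth and the passage from local to global bounds\<close>

lemma abs_le_one_plus_square: "\<bar>y\<bar> \<le> 1 + y\<^sup>2" for y :: real
proof (cases "\<bar>y\<bar> \<le> 1")
  case False
  then have "\<bar>y\<bar> \<le> \<bar>y\<bar>\<^sup>2"
    by (intro self_le_power) auto
  then show ?thesis by simp
qed (use zero_le_power2[of y] in linarith)

text \<open>The majorant \<open>(1 + y\<^sup>2) ^ N\<close> is a polynomial, so its products with
  polynomials are integrable. The factor \<open>2 ^ N\<close> comes from
  \<open>1 + \<bar>y\<bar> \<le> 2 * (1 + y\<^sup>2)\<close>.\<close>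

lemma poly_growth_on_imp_bound:
  assumes "poly_growth_on I g"
  shows "\<exists>C\<ge>0. \<exists>N. \<forall>y\<in>I. \<bar>g y\<bar> \<le> C * (1 + y\<^sup>2) ^ N"
proof -
  obtain C r where C: "C > 0" "r \<ge> 0" "\<And>y. y \<in> I \<Longrightarrow> \<bar>g y\<bar> \<le> C * (1 + \<bar>y\<bar>) powr r"
    using assms by (auto simp: poly_growth_on_def)
  define N where "N = nat \<lceil>r\<rceil>"
  have "\<bar>g y\<bar> \<le> (C * 2 ^ N) * (1 + y\<^sup>2) ^ N" if "y \<in> I" for y
  proof -
    have "(1 + \<bar>y\<bar>) powr r \<le> (1 + \<bar>y\<bar>) powr real N"
      by (intro powr_mono) (auto simp: N_def real_nat_ceiling_ge)
    also have "\<dots> = (1 + \<bar>y\<bar>) ^ N"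
      by (intro powr_realpow) auto
    also have "\<dots> \<le> (2 * (1 + y\<^sup>2)) ^ N"
    proof (rule power_mono)
      show "1 + \<bar>y\<bar> \<le> 2 * (1 + y\<^sup>2)"
        using abs_le_one_plus_square[of y] zero_le_power2[of y] by argo
    qed auto
    finally have "C * (1 + \<bar>y\<bar>) powr r \<le> C * (2 * (1 + y\<^sup>2)) ^ N"
      using C(1) by simp
    with C(3)[OF that] show ?thesis
      by (simp only: power_mult_distrib mult.assoc)
  qed
  then show ?thesis
    using C(1) by (intro exI[of _ "C * 2 ^ N"] conjI exI[of _ N]) auto
qed

lemma continuous_on_closed_imp_bound:
  assumes "continuous_on I g" "closed I" "\<not> bounded I \<Longrightarrow> poly_growth_on I g"
  shows "\<exists>C\<ge>0. \<exists>N. \<forall>y\<in>I. \<bar>g y\<bar> \<le> C * (1 + y\<^sup>2) ^ N"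
proof (cases "bounded I")
  case True
  then have "compact (g ` I)"
    using assms by (intro compact_continuous_image) (auto simp: compact_eq_bounded_closed)
  then obtain C where "\<forall>y\<in>I. \<bar>g y\<bar> \<le> C"
    using compact_imp_bounded by (fastforce simp: bounded_iff)
  then show ?thesis
    by (intro exI[of _ "\<bar>C\<bar>"] conjI exI[of _ 0]) (auto intro: order_trans[OF _ abs_ge_self])
qed (use assms poly_growth_on_imp_bound in blast)

text \<open>Recentering at \<open>x\<close> costs a factor uniform in
  \<open>\<bar>x\<bar> \<le> b\<close>: the parallelogram identity gives
  \<open>(x + h)\<^sup>2 \<le> 2 * x\<^sup>2 + 2 * h\<^sup>2\<close>, hence \<open>1 + (x +
  h)\<^sup>2 \<le> 2 * (1 + b\<^sup>2) * (1 + h\<^sup>2)\<close>.\<close>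

lemma growth_bound_shift:
  fixes g :: "real \<Rightarrow> real"
  assumes "\<And>y. y \<in> I \<Longrightarrow> \<bar>g y\<bar> \<le> C * (1 + y\<^sup>2) ^ N" "C \<ge> 0" "\<bar>x\<bar> \<le> b" "x + h \<in> I"
  shows "\<bar>g (x + h)\<bar> \<le> C * (2 * (1 + b\<^sup>2)) ^ N * (1 + h\<^sup>2) ^ N"
proof -
  have "(x + h)\<^sup>2 + (x - h)\<^sup>2 = 2 * x\<^sup>2 + 2 * h\<^sup>2"
    by (simp add: power2_eq_square algebra_simps)
  then have "(x + h)\<^sup>2 \<le> 2 * x\<^sup>2 + 2 * h\<^sup>2"
    using zero_le_power2[of "x - h"] by linarith
  moreover have "x\<^sup>2 \<le> b\<^sup>2"
    using assms(3) by (metis abs_ge_zero power2_abs power_mono)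
  moreover have "0 \<le> b\<^sup>2 * h\<^sup>2"
    by simp
  moreover have "2 * (1 + b\<^sup>2) * (1 + h\<^sup>2) = 2 + 2 * b\<^sup>2 + 2 * h\<^sup>2 + 2 * (b\<^sup>2 * h\<^sup>2)"
    by (simp add: algebra_simps)
  ultimately have "1 + (x + h)\<^sup>2 \<le> 2 * (1 + b\<^sup>2) * (1 + h\<^sup>2)"
    by linarith
  then have "(1 + (x + h)\<^sup>2) ^ N \<le> (2 * (1 + b\<^sup>2) * (1 + h\<^sup>2)) ^ N"
    by (intro power_mono) auto
  then have "C * (1 + (x + h)\<^sup>2) ^ N \<le> C * (2 * (1 + b\<^sup>2) * (1 + h\<^sup>2)) ^ N"
    using assms(2) by (rule mult_left_mono)
  with assms(1)[OF assms(4)] show ?thesis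
    by (simp only: power_mult_distrib mult.assoc)
qed

text \<open>For \<open>\<bar>h\<bar> \<ge> \<rho>\<close> the quotient
  \<open>\<bar>h\<bar> ^ Suc n / \<rho> ^ Suc n\<close> is at least \<open>1\<close>, so the growth
  bound may be multiplied by it. The extra power of \<open>\<bar>h\<bar>\<close> later yields a
  factor \<open>\<delta>\<close>.\<close>

lemma local_and_growth_bound:
  fixes u h :: real
  assumes "\<rho> > 0" "\<eta> \<ge> 0" "C \<ge> 0" "\<bar>h\<bar> < \<rho> \<Longrightarrow> u \<le> \<eta> * \<bar>h\<bar> ^ n" "u \<le> C * (1 + h\<^sup>2) ^ N"
  shows "u \<le> \<bar>h\<bar> ^ n * (\<eta> + C / \<rho> ^ Suc n * \<bar>h\<bar> * (1 + h\<^sup>2) ^ N)"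
proof (cases "\<bar>h\<bar> < \<rho>")
  case True
  have "u \<le> \<bar>h\<bar> ^ n * (\<eta> + 0)"
    using assms(4)[OF True] by (simp add: mult.commute)
  also have "\<dots> \<le> \<bar>h\<bar> ^ n * (\<eta> + C / \<rho> ^ Suc n * \<bar>h\<bar> * (1 + h\<^sup>2) ^ N)"
    using assms(1,3) by (intro mult_left_mono add_left_mono) auto
  finally show ?thesis .
next
  case False
  then have "\<rho> ^ Suc n \<le> \<bar>h\<bar> ^ Suc n"
    using assms(1) by (intro power_mono) auto
  then have "1 \<le> \<bar>h\<bar> ^ Suc n / \<rho> ^ Suc n"
    using assms(1) by (subst le_divide_eq_1_pos) auto
  then have "C * (1 + h\<^sup>2) ^ N * 1 \<le> C * (1 + h\<^sup>2) ^ N * (\<bar>h\<bar> ^ Suc n / \<rho> ^ Suc n)"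
    using assms(3) by (intro mult_left_mono) auto
  also have "\<dots> = \<bar>h\<bar> ^ n * (0 + C / \<rho> ^ Suc n * \<bar>h\<bar> * (1 + h\<^sup>2) ^ N)"
    by simp
  also have "\<dots> \<le> \<bar>h\<bar> ^ n * (\<eta> + C / \<rho> ^ Suc n * \<bar>h\<bar> * (1 + h\<^sup>2) ^ N)"
    using assms(2) by (intro mult_left_mono add_right_mono) auto
  finally show ?thesis
    using assms(5) by simp
qed

section \<open>Pointwise and uniform remainder estimates on the interval\<close>

lemma nderiv_within_has_derivative:
  assumes "nderiv_within I k f differentiable (at y within I)"
  shows "(nderiv_within I k f has_real_derivative nderiv_within I (Suc k) f y) (at y within I)"
  using assms by (simp add: vector_derivative_works has_real_derivative_iff_has_vector_derivative)

text \<open>For \<open>n > 0\<close> the derivative of order \<open>n - 1\<close> has a first-order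
  expansion at \<open>x\<close>; the lower ones are differentiable near \<open>x\<close>, so this
  expansion can be integrated up to \<open>f\<close>. For \<open>n = 0\<close> the claim is
  continuity.\<close>

lemma peano_remainder:
  assumes I: "is_interval I" "x \<in> I" "continuous_on I f"
    and diff: "\<forall>k\<in>{1..n}. nth_diff_within I k f x" and "\<eta> > 0"
  shows "\<exists>\<rho>>0. \<forall>h. \<bar>h\<bar> < \<rho> \<longrightarrow> x + h \<in> I \<longrightarrow>
    \<bar>f (x + h) - (\<Sum>k\<le>n. nderiv_within I k f x / fact k * h ^ k)\<bar> \<le> \<eta> * \<bar>h\<bar> ^ n"
proof (cases n)
  case 0
  then show ?thesis
    using I(2,3) \<open>\<eta> > 0\<close> unfolding continuous_on_iff dist_real_def
    by (fastforce intro: less_imp_le)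
next
  case (Suc l)
  define F where "F k = nderiv_within I k f" for k
  have "nth_diff_within I (Suc l) f x"
    using Suc by (intro bspec[OF diff]) simp
  then have "nderiv_within I l f differentiable (at x within I)"
    by simp
  then have "(F l has_real_derivative F n x) (at x within I)"
    unfolding F_def Suc by (rule nderiv_within_has_derivative)
  then obtain \<rho>1 where \<rho>1: "\<rho>1 > 0"
    "\<And>y. y \<in> I \<Longrightarrow> \<bar>y - x\<bar> < \<rho>1 \<Longrightarrow> \<bar>F l y - F l x - F n x * (y - x)\<bar> \<le> \<eta> * \<bar>y - x\<bar>"
    using \<open>\<eta> > 0\<close> unfolding has_field_derivative_def has_derivative_within_alt by fastforce
  have "\<forall>\<^sub>F y in nhds x. \<forall>k\<in>{..<l}. y \<in> I \<longrightarrow> F k differentiable (at y within I)"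
  proof (intro eventually_ball_finite ballI)
    fix k assume "k \<in> {..<l}"
    \<comment> \<open>Since \<open>k + 2 \<le> n\<close>, the derivative of order
      \<open>k + 2\<close> exists at \<open>x\<close>, which includes existence of order
      \<open>k + 1\<close> at nearby points of \<open>I\<close>.\<close>
    then have "nth_diff_within I (Suc (Suc k)) f x"
      using Suc by (intro bspec[OF diff]) simp
    then have "\<forall>\<^sub>F y in nhds x. y \<in> I \<longrightarrow> nth_diff_within I (Suc k) f y"
      by simp
    then show "\<forall>\<^sub>F y in nhds x. y \<in> I \<longrightarrow> F k differentiable (at y within I)"
      by eventually_elim (simp add: F_def)
  qed auto
  then obtain \<rho>2 where \<rho>2: "\<rho>2 > 0"
    "\<And>y k. \<bar>y - x\<bar> < \<rho>2 \<Longrightarrow> k < l \<Longrightarrow> y \<in> I \<Longrightarrow> F k differentiable (at y within I)"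
    by (auto simp: eventually_nhds_metric dist_real_def)
  define S where "S = I \<inter> ball x (min \<rho>1 \<rho>2)"
  have S: "y \<in> S \<longleftrightarrow> y \<in> I \<and> \<bar>y - x\<bar> < \<rho>1 \<and> \<bar>y - x\<bar> < \<rho>2" for y
    by (auto simp: S_def dist_real_def)
  have "\<bar>F 0 y - (\<Sum>j\<le>n. F j x / fact j * (y - x) ^ j)\<bar> \<le> \<eta> * \<bar>y - x\<bar> ^ n" if "y \<in> S" for y
  proof (rule taylor_remainder_bound[where S = S and k = l])
    show "convex S"
      using I(1) by (auto simp: S_def is_interval_convex intro!: convex_Int)
    show "x \<in> S"
      using I(2) \<rho>1(1) \<rho>2(1) by (simp add: S)
    show "(F i has_real_derivative F (Suc i) y) (at y within S)" if "i < l" "y \<in> S" for i y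
    proof (rule DERIV_subset)
      show "(F i has_real_derivative F (Suc i) y) (at y within I)"
        using \<rho>2(2)[of y i] that unfolding F_def by (intro nderiv_within_has_derivative) (auto simp: S)
    qed (simp add: S_def)
    show "\<bar>F l y - (\<Sum>j\<le>n - l. F (l + j) x / fact j * (y - x) ^ j)\<bar> \<le> \<eta> * \<bar>y - x\<bar> ^ (n - l)"
      if "y \<in> S" for y
      using \<rho>1(2)[of y] that by (simp add: S Suc algebra_simps)
  qed (use that Suc \<open>\<eta> > 0\<close> in auto)
  then have "\<bar>f (x + h) - (\<Sum>k\<le>n. nderiv_within I k f x / fact k * h ^ k)\<bar> \<le> \<eta> * \<bar>h\<bar> ^ n"
    if "\<bar>h\<bar> < min \<rho>1 \<rho>2" "x + h \<in> I" for h
    using that by (force simp: S F_def)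
  then show ?thesis
    using \<rho>1(1) \<rho>2(1) by (intro exI[of _ "min \<rho>1 \<rho>2"]) auto
qed

lemma pointwise_remainder:
  assumes I: "is_interval I" "closed I" "x \<in> I" "continuous_on I f"
    and growth: "\<not> bounded I \<Longrightarrow> poly_growth_on I f"
    and diff: "\<forall>k\<in>{1..n}. nth_diff_within I k f x"
  shows "\<exists>N. \<forall>\<eta>>0. \<exists>D. \<forall>h. x + h \<in> I \<longrightarrow>
    \<bar>f (x + h) - (\<Sum>k\<le>n. nderiv_within I k f x / fact k * h ^ k)\<bar>
      \<le> \<bar>h\<bar> ^ n * (\<eta> + D * \<bar>h\<bar> * (1 + h\<^sup>2) ^ N)"
proof -
  define c where "c k = nderiv_within I k f x / fact k" for k
  obtain C N where C: "C \<ge> 0" "\<And>y. y \<in> I \<Longrightarrow> \<bar>f y\<bar> \<le> C * (1 + y\<^sup>2) ^ N"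
    using continuous_on_closed_imp_bound[OF I(4,2) growth] by blast
  \<comment> \<open>The first summand bounds \<open>f\<close> recentred at \<open>x\<close>; the
    second bounds the Taylor polynomial through
    \<open>\<bar>h\<bar> ^ k \<le> (1 + h\<^sup>2) ^ (N + n)\<close>. Neither involves
    \<open>\<eta>\<close>.\<close>
  define C' where "C' = C * (2 * (1 + \<bar>x\<bar>\<^sup>2)) ^ N + (\<Sum>k\<le>n. \<bar>c k\<bar>)"
  have "C' \<ge> 0"
    unfolding C'_def using C(1) by (intro add_nonneg_nonneg mult_nonneg_nonneg sum_nonneg) auto
  have growth': "\<bar>f (x + h) - (\<Sum>k\<le>n. c k * h ^ k)\<bar> \<le> C' * (1 + h\<^sup>2) ^ (N + n)"
    if "x + h \<in> I" for h
  proof -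
    have one: "1 \<le> 1 + h\<^sup>2"
      by simp
    have pow: "\<bar>h\<bar> ^ k \<le> (1 + h\<^sup>2) ^ (N + n)" if "k \<le> n" for k
    proof -
      have "\<bar>h\<bar> ^ k \<le> (1 + h\<^sup>2) ^ k"
        by (intro power_mono abs_le_one_plus_square) auto
      also have "\<dots> \<le> (1 + h\<^sup>2) ^ (N + n)"
        using that by (intro power_increasing one) auto
      finally show ?thesis .
    qed
    have "\<bar>\<Sum>k\<le>n. c k * h ^ k\<bar> \<le> (\<Sum>k\<le>n. \<bar>c k\<bar> * \<bar>h\<bar> ^ k)"
      using sum_abs[of "\<lambda>k. c k * h ^ k"] by (simp add: abs_mult power_abs)
    also have "\<dots> \<le> (\<Sum>k\<le>n. \<bar>c k\<bar> * (1 + h\<^sup>2) ^ (N + n))"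
      using pow by (intro sum_mono mult_left_mono) auto
    finally have "\<bar>\<Sum>k\<le>n. c k * h ^ k\<bar> \<le> (\<Sum>k\<le>n. \<bar>c k\<bar>) * (1 + h\<^sup>2) ^ (N + n)"
      by (simp add: sum_distrib_right)
    moreover have "\<bar>f (x + h)\<bar> \<le> C * (2 * (1 + \<bar>x\<bar>\<^sup>2)) ^ N * (1 + h\<^sup>2) ^ N"
      by (rule growth_bound_shift[OF C(2,1) order_refl that])
    moreover have "C * (2 * (1 + \<bar>x\<bar>\<^sup>2)) ^ N * (1 + h\<^sup>2) ^ N \<le> C * (2 * (1 + \<bar>x\<bar>\<^sup>2)) ^ N * (1 + h\<^sup>2) ^ (N + n)"
      using C(1) by (intro mult_left_mono power_increasing one) auto
    ultimately show ?thesis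
      unfolding C'_def distrib_right by linarith
  qed
  have "\<exists>D. \<forall>h. x + h \<in> I \<longrightarrow> \<bar>f (x + h) - (\<Sum>k\<le>n. c k * h ^ k)\<bar>
      \<le> \<bar>h\<bar> ^ n * (\<eta> + D * \<bar>h\<bar> * (1 + h\<^sup>2) ^ (N + n))" if \<eta>: "\<eta> > 0" for \<eta>
  proof -
    obtain \<rho> where \<rho>: "\<rho> > 0" "\<And>h. \<bar>h\<bar> < \<rho> \<Longrightarrow> x + h \<in> I \<Longrightarrow>
      \<bar>f (x + h) - (\<Sum>k\<le>n. c k * h ^ k)\<bar> \<le> \<eta> * \<bar>h\<bar> ^ n"
      using peano_remainder[OF I(1,3,4) diff \<eta>] unfolding c_def by blast
    show ?thesis
      using local_and_growth_bound[OF \<rho>(1) _ \<open>C' \<ge> 0\<close> \<rho>(2) growth'] \<eta>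
      by (intro exI[of _ "C' / \<rho> ^ Suc n"]) simp
  qed
  then show ?thesis
    unfolding c_def by blast
qed

text \<open>Uniform continuity near \<open>K\<close> and polynomial growth bound the oscillation of
  the top derivative with constants valid for all \<open>x \<in> K\<close>; integrating
  \<open>n\<close> times carries the bound over to \<open>f\<close>.\<close>

lemma uniform_remainder:
  assumes I: "is_interval I" "closed I" and K: "compact K" "K \<subseteq> I"
    and C_n: "C_n_on n I f" and growth: "poly_growth_on I (nderiv_within I n f)"
  shows "\<exists>N. \<forall>\<eta>>0. \<exists>D. \<forall>x\<in>K. \<forall>h. x + h \<in> I \<longrightarrow>
    \<bar>f (x + h) - (\<Sum>k\<le>n. nderiv_within I k f x / fact k * h ^ k)\<bar>
      \<le> \<bar>h\<bar> ^ n * (\<eta> + D * \<bar>h\<bar> * (1 + h\<^sup>2) ^ N)"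
proof -
  define F where "F k = nderiv_within I k f" for k
  have F_deriv: "(F k has_real_derivative F (Suc k) y) (at y within I)" if "k < n" "y \<in> I" for k y
    using C_n that unfolding F_def C_n_on_def by (intro nderiv_within_has_derivative) auto
  have F_cont: "continuous_on I (F n)"
    using C_n by (simp add: F_def C_n_on_def)
  obtain b where b: "\<And>x. x \<in> K \<Longrightarrow> \<bar>x\<bar> \<le> b"
    using compact_imp_bounded[OF K(1)] by (auto simp: bounded_iff)
  obtain C N where C: "C \<ge> 0" "\<And>y. y \<in> I \<Longrightarrow> \<bar>F n y\<bar> \<le> C * (1 + y\<^sup>2) ^ N"
    using poly_growth_on_imp_bound[OF growth] unfolding F_def by blast
  define C' where "C' = C * (2 * (1 + b\<^sup>2)) ^ N"
  have "C' \<ge> 0"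
    using C(1) by (simp add: C'_def)
  have growth': "\<bar>F n (x + h) - F n x\<bar> \<le> 2 * C' * (1 + h\<^sup>2) ^ N" if "x \<in> K" "x + h \<in> I" for x h
  proof -
    have "\<bar>F n (x + h)\<bar> \<le> C' * (1 + h\<^sup>2) ^ N"
      unfolding C'_def by (rule growth_bound_shift[OF C(2,1) b[OF that(1)] that(2)])
    moreover have "\<bar>F n x\<bar> \<le> C'"
      using growth_bound_shift[OF C(2,1) b[OF that(1)], where h = 0] that(1) K(2) by (auto simp: C'_def)
    moreover have "C' * 1 \<le> C' * (1 + h\<^sup>2) ^ N"
      using \<open>C' \<ge> 0\<close> by (intro mult_left_mono one_le_power) auto
    ultimately show ?thesis by simp
  qed
  have "\<exists>D. \<forall>x\<in>K. \<forall>h. x + h \<in> I \<longrightarrow>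
    \<bar>f (x + h) - (\<Sum>k\<le>n. F k x / fact k * h ^ k)\<bar> \<le> \<bar>h\<bar> ^ n * (\<eta> + D * \<bar>h\<bar> * (1 + h\<^sup>2) ^ N)"
    if \<eta>: "\<eta> > 0" for \<eta>
  proof -
    \<comment> \<open>The margin \<open>1\<close> keeps \<open>x + h\<close> in this compact set
      when \<open>\<bar>h\<bar> < 1\<close>, which is why \<open>\<rho>\<close> is capped at
      \<open>1\<close>.\<close>
    have "compact (I \<inter> cball 0 (b + 1))"
      using I(2) by (simp add: closed_Int_compact)
    then have "uniformly_continuous_on (I \<inter> cball 0 (b + 1)) (F n)"
      using F_cont by (intro compact_uniformly_continuous) (auto intro: continuous_on_subset)
    then obtain \<rho>0 where \<rho>0: "\<rho>0 > 0"
      "\<And>y z. y \<in> I \<inter> cball 0 (b + 1) \<Longrightarrow> z \<in> I \<inter> cball 0 (b + 1) \<Longrightarrow> \<bar>z - y\<bar> < \<rho>0 \<Longrightarrow>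
        \<bar>F n z - F n y\<bar> < \<eta>"
      using \<eta> unfolding uniformly_continuous_on_def dist_real_def by metis
    define \<rho> where "\<rho> = min 1 \<rho>0"
    have "\<rho> > 0"
      using \<rho>0(1) by (simp add: \<rho>_def)
    define D where "D = 2 * C' / \<rho>"
    have "D \<ge> 0"
      using \<open>\<rho> > 0\<close> \<open>C' \<ge> 0\<close> by (simp add: D_def)
    have osc: "\<bar>F n (x + h) - F n x\<bar> \<le> \<eta> + D * \<bar>h\<bar> * (1 + h\<^sup>2) ^ N"
      if "x \<in> K" "x + h \<in> I" for x h
    proof -
      \<comment> \<open>The factor \<open>\<bar>h\<bar> ^ 0\<close> matches the instance
        \<open>n = 0\<close> of \<open>local_and_growth_bound\<close>, so \<open>D\<close> contains
        only the first power of \<open>1 / \<rho>\<close>.\<close>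
      have "\<bar>F n (x + h) - F n x\<bar> \<le> \<eta> * \<bar>h\<bar> ^ 0" if "\<bar>h\<bar> < \<rho>"
        using \<rho>0(2)[of x "x + h"] b[OF \<open>x \<in> K\<close>] \<open>x \<in> K\<close> \<open>x + h \<in> I\<close> K(2) that
        by (force simp: \<rho>_def)
      from local_and_growth_bound[OF \<open>\<rho> > 0\<close> _ _ this growth'[OF that]] show ?thesis
        using \<open>\<eta> > 0\<close> \<open>C' \<ge> 0\<close> by (simp add: D_def)
    qed
    have "\<bar>f (x + h) - (\<Sum>k\<le>n. F k x / fact k * h ^ k)\<bar> \<le> \<bar>h\<bar> ^ n * (\<eta> + D * \<bar>h\<bar> * (1 + h\<^sup>2) ^ N)"
      if x: "x \<in> K" "x + h \<in> I" for x h
    proof -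
      \<comment> \<open>On this segment \<open>\<bar>y - x\<bar> \<le> \<bar>h\<bar>\<close>, so
        \<open>B\<close>, which depends on \<open>h\<close> but not on \<open>y\<close>, can serve
        as the constant of the Taylor estimate.\<close>
      define S where "S = closed_segment x (x + h)"
      define B where "B = \<eta> + D * \<bar>h\<bar> * (1 + h\<^sup>2) ^ N"
      have "convex I"
        using I(1) by (simp add: is_interval_convex)
      then have "S \<subseteq> I"
        unfolding S_def using x K(2) by (intro closed_segment_subset) auto
      have top: "\<bar>F n y - F n x\<bar> \<le> B" if "y \<in> S" for y
      proof -
        have y: "\<bar>y - x\<bar> \<le> \<bar>h\<bar>"
          using that by (auto simp: S_def closed_segment_eq_real_ivl split: if_splits)
        have "\<bar>F n y - F n x\<bar> \<le> \<eta> + D * \<bar>y - x\<bar> * (1 + (y - x)\<^sup>2) ^ N"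
          using osc[OF x(1), of "y - x"] that \<open>S \<subseteq> I\<close> by auto
        also have "\<dots> \<le> B"
          unfolding B_def using y \<open>D \<ge> 0\<close>
          by (intro add_left_mono mult_mono power_mono[of "1 + (y - x)\<^sup>2"]) (auto simp: abs_le_square_iff)
        finally show ?thesis .
      qed
      have "\<bar>F 0 (x + h) - (\<Sum>j\<le>n. F j x / fact j * (x + h - x) ^ j)\<bar> \<le> B * \<bar>x + h - x\<bar> ^ n"
      proof (rule taylor_remainder_bound[where S = S and k = n])
        show "(F i has_real_derivative F (Suc i) y) (at y within S)" if "i < n" "y \<in> S" for i y
          using F_deriv[of i y] that \<open>S \<subseteq> I\<close> DERIV_subset by blast
        show "B \<ge> 0"
          using \<open>\<eta> > 0\<close> \<open>D \<ge> 0\<close> by (simp add: B_def)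
      qed (use top in \<open>auto simp: S_def\<close>)
      then show ?thesis
        by (simp add: F_def B_def mult.commute)
    qed
    then show ?thesis by blast
  qed
  then show ?thesis
    unfolding F_def by blast
qed

subsection \<open>The asymptotic formula\<close>

text \<open>As \<open>I\<close> is an interval, the smaller of the bounds for the least and the greatest element of
  \<open>K\<close> serves for all of \<open>K\<close>.\<close>

lemma compact_imp_uniformly_admissible:
  assumes I: "is_interval I" and K: "compact K" "\<And>x. x \<in> K \<Longrightarrow> admissible M I x"
  shows "\<exists>\<epsilon>>0. \<forall>x\<in>K. \<forall>\<delta> \<xi>. 0 \<le> \<delta> \<longrightarrow> \<delta> \<le> \<epsilon> \<longrightarrow> \<xi> \<in> msupp M \<longrightarrow> x + \<delta> * \<xi> \<in> I"
proof (cases "K = {}")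
  case True
  then show ?thesis by (intro exI[of _ 1]) auto
next
  case False
  obtain a b where ab: "a \<in> K" "b \<in> K" "\<And>x. x \<in> K \<Longrightarrow> a \<le> x \<and> x \<le> b"
    using compact_attains_inf[OF K(1) False] compact_attains_sup[OF K(1) False] by metis
  obtain \<epsilon>a \<epsilon>b where \<epsilon>: "\<epsilon>a > 0" "\<epsilon>b > 0"
    "\<And>\<delta> \<xi>. 0 \<le> \<delta> \<Longrightarrow> \<delta> \<le> \<epsilon>a \<Longrightarrow> \<xi> \<in> msupp M \<Longrightarrow> a + \<delta> * \<xi> \<in> I"
    "\<And>\<delta> \<xi>. 0 \<le> \<delta> \<Longrightarrow> \<delta> \<le> \<epsilon>b \<Longrightarrow> \<xi> \<in> msupp M \<Longrightarrow> b + \<delta> * \<xi> \<in> I"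
    using K(2)[OF ab(1)] K(2)[OF ab(2)] unfolding admissible_def by metis
  have "x + \<delta> * \<xi> \<in> I" if "x \<in> K" "0 \<le> \<delta>" "\<delta> \<le> min \<epsilon>a \<epsilon>b" "\<xi> \<in> msupp M" for x \<delta> \<xi>
    using mem_is_interval_1_I[OF I \<epsilon>(3)[of \<delta> \<xi>] \<epsilon>(4)[of \<delta> \<xi>], of "x + \<delta> * \<xi>"] ab(3) that by simp
  then show ?thesis
    using \<epsilon>(1,2) by (intro exI[of _ "min \<epsilon>a \<epsilon>b"]) auto
qed

theorem theorem4p1:
  fixes M :: "real measure" and p :: "nat \<Rightarrow> real poly" and m n :: nat
    and I :: "real set" and f :: "real \<Rightarrow> real"
  assumes "orthogonality_measure M"
    and "orthogonal_polys M p"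
    and "m \<le> n" and "n \<in> op_degrees M"
    and "is_interval I" and "closed I"
    and "continuous_on I f"
    and "\<not> bounded I \<Longrightarrow> poly_growth_on I f"
  shows "(\<forall>x. admissible M I x \<longrightarrow> (\<forall>k\<in>{1..n}. nth_diff_within I k f x) \<longrightarrow>
            (\<lambda>\<delta>. op_deriv M p m n f x \<delta> - nderiv_within I m f x)
              \<in> o[at_right 0](\<lambda>\<delta>. \<delta> ^ (n - m)))
       \<and> (C_n_on n I f \<longrightarrow> poly_growth_on I (nderiv_within I n f) \<longrightarrow>
            (\<forall>K. compact K \<longrightarrow> K \<subseteq> I \<longrightarrow> (\<forall>x\<in>K. admissible M I x) \<longrightarrow>
               uniform_limit K
                 (\<lambda>\<delta> x. (op_deriv M p m n f x \<delta> - nderiv_within I m f x) / \<delta> ^ (n - m))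
                 (\<lambda>_. 0) (at_right 0)))"
proof -
  have limit: "uniform_limit K
      (\<lambda>\<delta> x. (op_deriv M p m n f x \<delta> - nderiv_within I m f x) / \<delta> ^ (n - m)) (\<lambda>_. 0) (at_right 0)"
    if K: "compact K" "\<forall>x\<in>K. admissible M I x"
      and rem: "\<forall>\<eta>>0. \<exists>D. \<forall>x\<in>K. \<forall>h. x + h \<in> I \<longrightarrow>
        \<bar>f (x + h) - (\<Sum>k\<le>n. nderiv_within I k f x / fact k * h ^ k)\<bar>
          \<le> \<bar>h\<bar> ^ n * (\<eta> + D * \<bar>h\<bar> * (1 + h\<^sup>2) ^ N)" for K N
  proof -
    obtain \<epsilon> where \<epsilon>: "\<epsilon> > 0"
      "\<And>x \<delta> \<xi>. x \<in> K \<Longrightarrow> 0 \<le> \<delta> \<Longrightarrow> \<delta> \<le> \<epsilon> \<Longrightarrow> \<xi> \<in> msupp M \<Longrightarrow> x + \<delta> * \<xi> \<in> I"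
      using compact_imp_uniformly_admissible[OF assms(5) K(1)] K(2) by metis
    have "uniform_limit K (\<lambda>\<delta> x. (op_deriv M p m n f x \<delta> -
        fact m * (nderiv_within I m f x / fact m)) / \<delta> ^ (n - m)) (\<lambda>_. 0) (at_right 0)"
    proof (rule op_deriv_uniform_limit[where N = N, OF assms(1-4,7) \<epsilon>(1)])
      show "x + \<delta> * \<xi> \<in> I" if "x \<in> K" "0 \<le> \<delta>" "\<delta> \<le> \<epsilon>" "\<xi> \<in> msupp M" for x \<delta> \<xi>
        using that by (rule \<epsilon>(2))
    qed (rule rem[rule_format])
    then show ?thesis by simp
  qed
  have pointwise: "(\<lambda>\<delta>. op_deriv M p m n f x \<delta> - nderiv_within I m f x) \<in> o[at_right 0](\<lambda>\<delta>. \<delta> ^ (n - m))"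
    if adm: "admissible M I x" and diff: "\<forall>k\<in>{1..n}. nth_diff_within I k f x" for x
  proof (rule smalloI_tendsto)
    \<comment> \<open>The support is nonempty, so the case \<open>\<delta> = 0\<close> of
      admissibility puts \<open>x\<close> itself in \<open>I\<close>.\<close>
    have "x \<in> I"
      using adm assms(1) unfolding admissible_def orthogonality_measure_def
      by (metis add.right_neutral all_not_in_conv less_imp_le mult_zero_left order_refl)
    obtain N where "\<forall>\<eta>>0. \<exists>D. \<forall>h. x + h \<in> I \<longrightarrow>
        \<bar>f (x + h) - (\<Sum>k\<le>n. nderiv_within I k f x / fact k * h ^ k)\<bar>
          \<le> \<bar>h\<bar> ^ n * (\<eta> + D * \<bar>h\<bar> * (1 + h\<^sup>2) ^ N)"
      using pointwise_remainder[OF assms(5,6) \<open>x \<in> I\<close> assms(7,8) diff] by blast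
    then show "((\<lambda>\<delta>. (op_deriv M p m n f x \<delta> - nderiv_within I m f x) / \<delta> ^ (n - m)) \<longlongrightarrow> 0) (at_right 0)"
      using limit[of "{x}" N] adm by simp
    show "\<forall>\<^sub>F \<delta> in at_right 0. \<delta> ^ (n - m) \<noteq> (0::real)"
      using eventually_at_right_less[of "0::real"] by eventually_elim simp
  qed
  show ?thesis
  proof (intro conjI allI impI)
    fix K
    assume f: "C_n_on n I f" "poly_growth_on I (nderiv_within I n f)"
      and K: "compact K" "K \<subseteq> I" "\<forall>x\<in>K. admissible M I x"
    from uniform_remainder[OF assms(5,6) K(1,2) f] obtain N where
      "\<forall>\<eta>>0. \<exists>D. \<forall>x\<in>K. \<forall>h. x + h \<in> I \<longrightarrow>
        \<bar>f (x + h) - (\<Sum>k\<le>n. nderiv_within I k f x / fact k * h ^ k)\<bar>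
          \<le> \<bar>h\<bar> ^ n * (\<eta> + D * \<bar>h\<bar> * (1 + h\<^sup>2) ^ N)" ..
    with limit[OF K(1,3)] show "uniform_limit K
      (\<lambda>\<delta> x. (op_deriv M p m n f x \<delta> - nderiv_within I m f x) / \<delta> ^ (n - m)) (\<lambda>_. 0) (at_right 0)" .
  qed (rule pointwise)
qed

end
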